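(* Let $ABC$ be a (non-degenerate) triangle in the plane and let $\alpha,\beta,\gamma\in(0,\pi)$ satisfy $\alpha+\beta+\gamma=\pi$. For each of the six ordered triples $(\theta_1,\theta_2,\theta_3)\in\{(\alpha,\beta,\gamma),(\alpha,\gamma,\beta),(\beta,\alpha,\gamma),(\beta,\gamma,\alpha),(\gamma,\alpha,\beta),(\gamma,\beta,\alpha)\}$, let $\Delta_{\theta_1\theta_2\theta_3}$ be the area-minimizing triangle in the class $\mathcal{I}_{\theta_1\theta_2\theta_3}$, and let $P_{\theta_1\theta_2\theta_3}$ be its pedal point with respect to $ABC$. Then there exists a circle that contains all six points $$P_{\alpha\beta\gamma},\ P_{\alpha\gamma\beta},\ P_{\beta\alpha\gamma},\ P_{\beta\gamma\alpha},\ P_{\gamma\alpha\beta},\ P_{\gamma\beta\alpha}.$$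
   Context: For a fixed triangle $ABC$ and an ordered triple of angles $(\theta_1,\theta_2,\theta_3)$ in $(0,\pi)$ with $\theta_1+\theta_2+\theta_3=\pi$, $\mathcal{I}_{\theta_1\theta_2\theta_3}$ denotes the set of all triangles $XYZ$ such that $X$ lies on line $BC$, $Y$ lies on line $AC$, $Z$ lies on line $AB$, and the (unoriented) angles of $XYZ$ at $X,Y,Z$ are $\theta_1,\theta_2,\theta_3$, in this order. Each class $\mathcal{I}_{\theta_1\theta_2\theta_3}$ contains a unique triangle of smallest area (its area-minimizing triangle), and this triangle is the pedal triangle of some point with respect to $ABC$. The pedal triangle of a point $P$ with respect to $ABC$ is the triangle whose vertices are the orthogonal projections of $P$ onto the lines $BC$, $AC$, $AB$; $P$ is then called the pedal point of that triangle. The six points in the claim need not be distinct. *)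

theory Defs
  imports "HOL-Analysis.Analysis"
begin

type_synonym point = "real ^ 2"

text \<open>
  A triangle is an ordered triple of vertices, since the angles and the side lines that the
  vertices lie on are prescribed vertex by vertex.
\<close>

type_synonym triangle = "point \<times> point \<times> point"

abbreviation line :: "point \<Rightarrow> point \<Rightarrow> point set" where
  "line A B \<equiv> affine hull {A, B}"

text \<open>The unoriented angle \<open>YXZ\<close> at \<open>X\<close>, in \<open>[0, \<pi>]\<close>; meaningful if \<open>Y \<noteq> X\<close> and \<open>Z \<noteq> X\<close>.\<close>

definition angle_at :: "point \<Rightarrow> point \<Rightarrow> point \<Rightarrow> real" where
  "angle_at X Y Z = arccos (((Y - X) \<bullet> (Z - X)) / (norm (Y - X) * norm (Z - X)))"

fun triangle_area :: "triangle \<Rightarrow> real" where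
  "triangle_area (X, Y, Z) = measure lborel (convex hull {X, Y, Z})"

definition inscribed_class ::
  "point \<Rightarrow> point \<Rightarrow> point \<Rightarrow> real \<Rightarrow> real \<Rightarrow> real \<Rightarrow> triangle set" where
  "inscribed_class A B C \<theta>1 \<theta>2 \<theta>3 =
     {(X, Y, Z). \<not> collinear {X, Y, Z} \<and>
        X \<in> line B C \<and> Y \<in> line A C \<and> Z \<in> line A B \<and>
        angle_at X Y Z = \<theta>1 \<and> angle_at Y X Z = \<theta>2 \<and> angle_at Z X Y = \<theta>3}"

definition is_area_minimizing :: "triangle set \<Rightarrow> triangle \<Rightarrow> bool" where
  "is_area_minimizing S T \<longleftrightarrow> T \<in> S \<and> (\<forall>T' \<in> S. triangle_area T \<le> triangle_area T')"

text \<open>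
  Definite description, because the minimizer is unique for every nondegenerate \<open>ABC\<close> and
  positive angles of sum \<open>\<pi>\<close>.
\<close>

definition min_triangle ::
  "point \<Rightarrow> point \<Rightarrow> point \<Rightarrow> real \<Rightarrow> real \<Rightarrow> real \<Rightarrow> triangle" where
  "min_triangle A B C \<theta>1 \<theta>2 \<theta>3 =
     (THE T. is_area_minimizing (inscribed_class A B C \<theta>1 \<theta>2 \<theta>3) T)"

definition is_foot :: "point \<Rightarrow> point \<Rightarrow> point \<Rightarrow> point \<Rightarrow> bool" where
  "is_foot P A B F \<longleftrightarrow> F \<in> line A B \<and> orthogonal (P - F) (B - A)"

fun is_pedal_triangle :: "point \<Rightarrow> point \<Rightarrow> point \<Rightarrow> point \<Rightarrow> triangle \<Rightarrow> bool" where
  "is_pedal_triangle A B C P (X, Y, Z) \<longleftrightarrow>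
     is_foot P B C X \<and> is_foot P A C Y \<and> is_foot P A B Z"

text \<open>
  A point is determined by its projections onto two nonparallel lines, so a triangle has at most
  one pedal point with respect to a nondegenerate \<open>ABC\<close>.
\<close>

definition pedal_point :: "point \<Rightarrow> point \<Rightarrow> point \<Rightarrow> triangle \<Rightarrow> point" where
  "pedal_point A B C T = (THE P. is_pedal_triangle A B C P T)"

definition min_pedal_point ::
  "point \<Rightarrow> point \<Rightarrow> point \<Rightarrow> real \<Rightarrow> real \<Rightarrow> real \<Rightarrow> point" where
  "min_pedal_point A B C \<theta>1 \<theta>2 \<theta>3 = pedal_point A B C (min_triangle A B C \<theta>1 \<theta>2 \<theta>3)"

end

theory Submission
  imports Defs
begin

text \<open>
  Let \<open>D\<close> be twice the signed area of \<open>ABC\<close>. A triangle \<open>XYZ\<close> with the prescribed angles is fixed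
  by \<open>X\<close>, the vector \<open>s = Y - X\<close> and its orientation, since \<open>Z - X\<close> arises from \<open>s\<close> by one of two
  conjugate similarities of the plane. Once the orientation is chosen, the requirement that the
  vertices lie on the side lines determines \<open>X\<close> from \<open>s\<close> and becomes a single linear equation
  \<open>f \<times> s = - D\<close>, where the vector \<open>f\<close> depends on \<open>ABC\<close>, the angles and the orientation
  (\<open>inscribed_apex_unique\<close>). The area is proportional to \<open>|s|\<^sup>2\<close>, and by Lagrange's identity
  \<open>|f|\<^sup>2 |s|\<^sup>2 = D\<^sup>2 + (f \<bullet> s)\<^sup>2\<close>. So within one orientation the minimum is attained exactly where
  \<open>f \<bullet> s = 0\<close>, and this is precisely the condition that the perpendiculars to the side lines at
  \<open>X\<close>, \<open>Y\<close>, \<open>Z\<close> are concurrent, that is, that \<open>XYZ\<close> is a pedal triangle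
  (\<open>pedal_point_is_pedal\<close>). The vector \<open>f\<close> is strictly longer for the orientation of \<open>ABC\<close>
  (\<open>base_normal_norm_diff\<close>), so the minimizer has that orientation (\<open>min_triangle_eq\<close>).

  For a triangle with angles \<open>\<theta>1, \<theta>2, \<theta>3\<close> the ratio of the sum of the squared sides to the area
  is a symmetric function of the angles (\<open>apex_sides\<close>), hence the same for all six minimizers.
  For the pedal triangle of \<open>P\<close>, each squared side is a multiple of the squared distance of \<open>P\<close>
  from a vertex of \<open>ABC\<close> (\<open>pedal_side\<close>), and the signed area is a positive multiple of
  \<open>D (R\<^sup>2 - |P - O|\<^sup>2)\<close>, with \<open>O\<close> and \<open>R\<close> the circumcenter and circumradius of \<open>ABC\<close>
  (\<open>pedal_area\<close>). All six pedal points therefore satisfy one equation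
  \<open>a PA\<^sup>2 + b PB\<^sup>2 + c PC\<^sup>2 = K (R\<^sup>2 - PO\<^sup>2)\<close> with positive coefficients (\<open>min_pedal_point_eqn\<close>),
  which describes a circle or a single point.
\<close>

section \<open>Vectors, lines and angles in the plane\<close>

text \<open>The vector turned by a right angle counterclockwise.\<close>

definition perp :: "point \<Rightarrow> point" where
  "perp v = vector [- v $ 2, v $ 1]"

text \<open>The signed area of the parallelogram spanned by two vectors.\<close>

definition cross2 :: "point \<Rightarrow> point \<Rightarrow> real" where
  "cross2 u v = u $ 1 * v $ 2 - u $ 2 * v $ 1"

lemma inner_2: "u \<bullet> v = u $ 1 * v $ 1 + u $ 2 * v $ 2" for u v :: point
  by (simp add: inner_vec_def sum_2)

lemma perp_nth [simp]: "perp v $ 1 = - v $ 2" "perp v $ 2 = v $ 1"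
  by (simp_all add: perp_def)

lemma point_eq_iff: "u = v \<longleftrightarrow> u $ 1 = v $ 1 \<and> u $ 2 = v $ 2" for u v :: point
  by (simp add: vec_eq_iff forall_2)

lemmas coords = inner_2 cross2_def point_eq_iff

lemma lagrange_identity: "(u \<bullet> u) * (v \<bullet> v) = (cross2 u v)\<^sup>2 + (u \<bullet> v)\<^sup>2"
  by (simp add: coords power2_eq_square algebra_simps)

lemma norm_mult_square: "(norm u * norm v)\<^sup>2 = (cross2 u v)\<^sup>2 + (u \<bullet> v)\<^sup>2" for u v :: point
  by (simp add: power_mult_distrib power2_norm_eq_inner lagrange_identity)

lemma collinear_iff_cross2: "collinear {X, Y, Z} \<longleftrightarrow> cross2 (Y - X) (Z - X) = 0"
proof -
  have "collinear {X, Y, Z} \<longleftrightarrow> collinear {Y, X, Z}"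
    by (simp add: insert_commute)
  also have "\<dots> \<longleftrightarrow> collinear {0, Y - X, Z - X}"
    by (rule collinear_3) (simp add: NO_MATCH_def)
  also have "\<dots> \<longleftrightarrow> \<bar>(Y - X) \<bullet> (Z - X)\<bar> = norm (Y - X) * norm (Z - X)"
    by (simp add: norm_cauchy_schwarz_equal)
  also have "\<dots> \<longleftrightarrow> \<bar>(Y - X) \<bullet> (Z - X)\<bar>\<^sup>2 = (norm (Y - X) * norm (Z - X))\<^sup>2"
    by (subst power2_eq_iff_nonneg) auto
  also have "\<dots> \<longleftrightarrow> cross2 (Y - X) (Z - X) = 0"
    unfolding norm_mult_square by simp
  finally show ?thesis .
qed

lemma mem_line_iff:
  assumes "A \<noteq> B"
  shows "X \<in> line A B \<longleftrightarrow> cross2 (B - A) (X - A) = 0"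
  using assms collinear_iff_cross2[of A B X] affine_hull_3_imp_collinear collinear_3_imp_in_affine_hull
  by metis

lemma linear_system_unique_solution:
  assumes "cross2 a b \<noteq> 0"
  shows "\<exists>!P. a \<bullet> P = r \<and> b \<bullet> P = t"
proof
  let ?P = "(1 / cross2 a b) *\<^sub>R (t *\<^sub>R perp a - r *\<^sub>R perp b)"
  have "cross2 a b * (a \<bullet> ?P) = cross2 a b * r" "cross2 a b * (b \<bullet> ?P) = cross2 a b * t"
    using assms by (simp_all add: inner_diff_right) (simp_all add: coords algebra_simps)
  then show "a \<bullet> ?P = r \<and> b \<bullet> ?P = t"
    using assms by simp
next
  fix P assume P: "a \<bullet> P = r \<and> b \<bullet> P = t"
  have "cross2 a b *\<^sub>R P = t *\<^sub>R perp a - r *\<^sub>R perp b"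
    using P by (auto simp: coords algebra_simps)
  then have "(1 / cross2 a b) *\<^sub>R (cross2 a b *\<^sub>R P)
      = (1 / cross2 a b) *\<^sub>R (t *\<^sub>R perp a - r *\<^sub>R perp b)"
    by simp
  then show "P = (1 / cross2 a b) *\<^sub>R (t *\<^sub>R perp a - r *\<^sub>R perp b)"
    using assms by simp
qed

lemma triangle_area_eq: "triangle_area (X, Y, Z) = \<bar>cross2 (Y - X) (Z - X)\<bar> / 2"
  by (simp add: content_triangle cross2_def abs_minus_commute mult.commute)

lemma angle_at_imp:
  assumes "angle_at X Y Z = \<theta>" "Y \<noteq> X" "Z \<noteq> X"
  shows "(Y - X) \<bullet> (Z - X) = norm (Y - X) * norm (Z - X) * cos \<theta>"
    and "\<bar>cross2 (Y - X) (Z - X)\<bar> = norm (Y - X) * norm (Z - X) * sin \<theta>"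
proof -
  define n where "n = norm (Y - X) * norm (Z - X)"
  define c where "c = (Y - X) \<bullet> (Z - X) / n"
  have n: "n > 0" using assms by (simp add: n_def)
  have "\<bar>(Y - X) \<bullet> (Z - X)\<bar> \<le> n"
    unfolding n_def by (rule Cauchy_Schwarz_ineq2)
  then have c: "\<bar>c\<bar> \<le> 1" using n by (simp add: c_def)
  have \<theta>: "\<theta> = arccos c" using assms by (simp add: angle_at_def c_def n_def)
  have cos: "cos \<theta> = c" using c \<theta> by (simp add: cos_arccos_abs)
  show dot: "(Y - X) \<bullet> (Z - X) = norm (Y - X) * norm (Z - X) * cos \<theta>"
    using n cos by (simp add: c_def flip: n_def)
  have sin: "sin \<theta> \<ge> 0"
    using c \<theta> arccos_lbound[of c] arccos_ubound[of c] by (intro sin_ge_zero) auto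
  have "\<bar>cross2 (Y - X) (Z - X)\<bar>\<^sup>2 = n\<^sup>2 - (n * cos \<theta>)\<^sup>2"
    using norm_mult_square[of "Y - X" "Z - X"] dot by (simp flip: n_def)
  also have "\<dots> = (n * sin \<theta>)\<^sup>2"
    by (simp add: power_mult_distrib sin_squared_eq algebra_simps)
  finally show "\<bar>cross2 (Y - X) (Z - X)\<bar> = norm (Y - X) * norm (Z - X) * sin \<theta>"
    using n sin by (subst (asm) power2_eq_iff_nonneg) (auto simp: n_def)
qed

text \<open>
  The factor \<open>k\<close> is necessarily the product of the lengths of the two sides, by Lagrange's identity.
\<close>

lemma angle_at_eqI:
  assumes "(Y - X) \<bullet> (Z - X) = k * cos \<theta>" "\<bar>cross2 (Y - X) (Z - X)\<bar> = k * sin \<theta>"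
    and "k > 0" "0 < \<theta>" "\<theta> < pi"
  shows "angle_at X Y Z = \<theta>"
proof -
  have "(norm (Y - X) * norm (Z - X))\<^sup>2 = \<bar>cross2 (Y - X) (Z - X)\<bar>\<^sup>2 + ((Y - X) \<bullet> (Z - X))\<^sup>2"
    by (simp add: norm_mult_square)
  also have "\<dots> = k\<^sup>2"
    unfolding assms using sin_cos_squared_add[of \<theta>]
    by (simp add: power_mult_distrib flip: distrib_left)
  finally have "norm (Y - X) * norm (Z - X) = k"
    using assms(3) by (subst (asm) power2_eq_iff_nonneg) auto
  then show ?thesis
    using assms by (simp add: angle_at_def arccos_cos)
qed

section \<open>Triangles with prescribed angles\<close>

text \<open>
  The image of \<open>Y\<close> under the spiral similarity with center \<open>X\<close> and multiplier \<open>p + i q\<close>, with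
  points read as complex numbers. A positive \<open>q\<close> gives a counterclockwise triangle \<open>XYZ\<close>.
\<close>

definition apex :: "real \<Rightarrow> real \<Rightarrow> point \<Rightarrow> point \<Rightarrow> point" where
  "apex p q X Y = X + p *\<^sub>R (Y - X) + q *\<^sub>R perp (Y - X)"

lemma cross2_apex: "cross2 (Y - X) (apex p q X Y - X) = q * ((Y - X) \<bullet> (Y - X))"
  by (simp add: apex_def coords algebra_simps)

lemma inner_apex: "(Y - X) \<bullet> (apex p q X Y - X) = p * ((Y - X) \<bullet> (Y - X))"
  by (simp add: apex_def coords algebra_simps)

lemma eq_apexI:
  assumes "X \<noteq> Y" "(Y - X) \<bullet> (Z - X) = p * ((Y - X) \<bullet> (Y - X))"
    and "cross2 (Y - X) (Z - X) = q * ((Y - X) \<bullet> (Y - X))"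
  shows "Z = apex p q X Y"
proof -
  define s where "s = Y - X"
  have s: "s \<bullet> s \<noteq> 0" using assms by (simp add: s_def)
  have "(s \<bullet> s) *\<^sub>R (Z - X) = (s \<bullet> (Z - X)) *\<^sub>R s + cross2 s (Z - X) *\<^sub>R perp s"
    by (simp add: coords algebra_simps)
  also have "\<dots> = (s \<bullet> s) *\<^sub>R (apex p q X Y - X)"
    using assms by (simp add: apex_def scaleR_add_right mult.commute flip: s_def)
  finally show ?thesis using s by simp
qed

text \<open>
  Real and imaginary part of the multiplier \<open>(sin \<theta>2 / sin \<theta>3) e\<^bsup>i \<theta>1\<^esup>\<close> that takes the side \<open>XY\<close> to
  the side \<open>XZ\<close> in a counterclockwise triangle with angles \<open>\<theta>1, \<theta>2, \<theta>3\<close> at \<open>X, Y, Z\<close>; the length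
  ratio is the law of sines.
\<close>

definition shape_re :: "real \<Rightarrow> real \<Rightarrow> real \<Rightarrow> real" where
  "shape_re \<theta>1 \<theta>2 \<theta>3 = sin \<theta>2 * cos \<theta>1 / sin \<theta>3"

definition shape_im :: "real \<Rightarrow> real \<Rightarrow> real \<Rightarrow> real" where
  "shape_im \<theta>1 \<theta>2 \<theta>3 = sin \<theta>2 * sin \<theta>1 / sin \<theta>3"

text \<open>The sign \<open>\<epsilon>\<close> is the orientation of the triangle, which unoriented angles leave open.\<close>

lemma similar_iff_apex:
  assumes "0 < \<theta>1" "0 < \<theta>2" "0 < \<theta>3" and sum: "\<theta>1 + \<theta>2 + \<theta>3 = pi"
  defines "p \<equiv> shape_re \<theta>1 \<theta>2 \<theta>3" and "q \<equiv> shape_im \<theta>1 \<theta>2 \<theta>3"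
  shows "\<not> collinear {X, Y, Z} \<and> angle_at X Y Z = \<theta>1 \<and> angle_at Y X Z = \<theta>2 \<and> angle_at Z X Y = \<theta>3
    \<longleftrightarrow> X \<noteq> Y \<and> (\<exists>\<epsilon>\<in>{1, -1}. Z = apex p (\<epsilon> * q) X Y)"
    (is "?L \<longleftrightarrow> ?R")
proof
  have pos: "sin \<theta>1 > 0" "sin \<theta>2 > 0" "sin \<theta>3 > 0"
    using assms by (auto intro!: sin_gt_zero)
  assume L: ?L
  define u v where "u = Y - X" and "v = Z - X"
  define n where "n = norm (Z - Y)"
  have nc: "cross2 u v \<noteq> 0"
    using L by (simp add: collinear_iff_cross2 u_def v_def)
  have ne: "Y \<noteq> X" "Z \<noteq> X" "Z \<noteq> Y"
    using nc by (auto simp: u_def v_def cross2_def)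
  have n: "n > 0" using ne by (simp add: n_def)
  have cr: "\<bar>cross2 (X - Y) (Z - Y)\<bar> = \<bar>cross2 u v\<bar>" "\<bar>cross2 (X - Z) (Y - Z)\<bar> = \<bar>cross2 u v\<bar>"
    unfolding u_def v_def cross2_def by (simp_all add: algebra_simps abs_minus_commute)
  have nm: "norm (X - Y) = norm u" "norm (X - Z) = norm v" "norm (Y - Z) = n"
    by (simp_all add: u_def v_def n_def norm_minus_commute)
  have 1: "u \<bullet> v = norm u * norm v * cos \<theta>1" "\<bar>cross2 u v\<bar> = norm u * norm v * sin \<theta>1"
    using angle_at_imp[of X Y Z \<theta>1] L ne by (auto simp: u_def v_def)
  have 2: "\<bar>cross2 u v\<bar> = norm u * n * sin \<theta>2"
    using angle_at_imp(2)[of Y X Z \<theta>2] L ne cr nm by (auto simp: n_def)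
  have 3: "\<bar>cross2 u v\<bar> = norm v * n * sin \<theta>3"
    using angle_at_imp(2)[of Z X Y \<theta>3] L ne cr nm by auto
  \<comment> \<open>law of sines, from two expressions for twice the area\<close>
  have "norm v * sin \<theta>3 = norm u * sin \<theta>2"
    using 2 3 n by simp
  then have v: "norm v = norm u * sin \<theta>2 / sin \<theta>3"
    using pos by (simp add: field_simps)
  have uu: "norm u * norm u = u \<bullet> u"
    by (simp add: dot_square_norm power2_eq_square)
  have "u \<bullet> v = p * (u \<bullet> u)" "\<bar>cross2 u v\<bar> = q * (u \<bullet> u)"
    unfolding 1 v p_def q_def shape_re_def shape_im_def uu[symmetric] by simp_all
  then have "u \<bullet> v = p * (u \<bullet> u)" "cross2 u v = 1 * q * (u \<bullet> u) \<or> cross2 u v = -1 * q * (u \<bullet> u)"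
    by auto
  then show ?R
    using eq_apexI[of X Y Z p "1 * q"] eq_apexI[of X Y Z p "-1 * q"] ne
    unfolding u_def v_def by blast
next
  have pos: "sin \<theta>1 > 0" "sin \<theta>2 > 0" "sin \<theta>3 > 0"
    using assms by (auto intro!: sin_gt_zero)
  have q: "q > 0" using pos by (simp add: q_def shape_im_def)
  assume ?R
  then obtain \<epsilon> where \<epsilon>: "\<epsilon> \<in> {1, -1}" and Z: "Z = apex p (\<epsilon> * q) X Y" and ne: "X \<noteq> Y"
    by blast
  define d where "d = (Y - X) \<bullet> (Y - X)"
  have d: "d > 0" using ne by (simp add: d_def)
  have cX: "\<bar>cross2 (Y - X) (Z - X)\<bar> = d * q"
    using \<epsilon> d q by (auto simp: Z cross2_apex abs_mult simp flip: d_def)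
  then have cY: "\<bar>cross2 (X - Y) (Z - Y)\<bar> = d * q" and cZ: "\<bar>cross2 (X - Z) (Y - Z)\<bar> = d * q"
    unfolding cross2_def by (simp_all add: algebra_simps abs_minus_commute)
  have iX: "(Y - X) \<bullet> (Z - X) = d * p"
    by (simp add: Z inner_apex d_def)
  have "(X - Y) \<bullet> (Z - Y) = d - (Y - X) \<bullet> (Z - X)"
    by (simp add: d_def inner_2 algebra_simps)
  then have iY: "(X - Y) \<bullet> (Z - Y) = d * (1 - p)"
    using iX by (simp add: algebra_simps)
  have eps2: "\<epsilon> * \<epsilon> = 1" using \<epsilon> by auto
  have "(X - Z) \<bullet> (Y - Z) = (Z - X) \<bullet> (Z - X) - (Y - X) \<bullet> (Z - X)"
    by (simp add: inner_2 algebra_simps)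
  also have "(Z - X) \<bullet> (Z - X) = d * (p\<^sup>2 + (\<epsilon> * \<epsilon>) * q\<^sup>2)"
    by (simp add: Z apex_def d_def inner_2 algebra_simps power2_eq_square)
  finally have iZ: "(X - Z) \<bullet> (Y - Z) = d * (p\<^sup>2 + q\<^sup>2 - p)"
    using iX eps2 by (simp add: algebra_simps)
  have s2: "sin \<theta>2 = sin \<theta>1 * cos \<theta>3 + cos \<theta>1 * sin \<theta>3"
  proof -
    have "\<theta>2 = pi - (\<theta>1 + \<theta>3)" using sum by simp
    then show ?thesis by (metis sin_add sin_pi_minus)
  qed
  have s3: "sin \<theta>3 = sin \<theta>1 * cos \<theta>2 + cos \<theta>1 * sin \<theta>2"
  proof -
    have "\<theta>3 = pi - (\<theta>1 + \<theta>2)" using sum by simp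
    then show ?thesis by (metis sin_add sin_pi_minus)
  qed
  have p1: "1 - p = sin \<theta>1 / sin \<theta>3 * cos \<theta>2"
    unfolding p_def shape_re_def using pos s3 by (simp add: field_simps)
  have "p\<^sup>2 + q\<^sup>2 = (sin \<theta>2)\<^sup>2 * ((cos \<theta>1)\<^sup>2 + (sin \<theta>1)\<^sup>2) / (sin \<theta>3)\<^sup>2"
    unfolding p_def q_def shape_re_def shape_im_def
    by (simp only: power_mult_distrib power_divide distrib_left add_divide_distrib)
  then have "p\<^sup>2 + q\<^sup>2 - p = sin \<theta>2 / (sin \<theta>3)\<^sup>2 * (sin \<theta>2 - cos \<theta>1 * sin \<theta>3)"
    unfolding p_def shape_re_def using pos by (simp add: field_simps power2_eq_square)
  also have "\<dots> = sin \<theta>1 * sin \<theta>2 / (sin \<theta>3)\<^sup>2 * cos \<theta>3"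
    using s2 by simp
  finally have pq: "p\<^sup>2 + q\<^sup>2 - p = sin \<theta>1 * sin \<theta>2 / (sin \<theta>3)\<^sup>2 * cos \<theta>3" .
  have "angle_at X Y Z = \<theta>1"
    by (rule angle_at_eqI[where k = "d * (sin \<theta>2 / sin \<theta>3)"])
       (use iX cX pos d assms in \<open>auto simp: p_def q_def shape_re_def shape_im_def\<close>)
  moreover have "angle_at Y X Z = \<theta>2"
    by (rule angle_at_eqI[where k = "d * (sin \<theta>1 / sin \<theta>3)"])
       (use iY p1 cY pos d assms in \<open>auto simp: q_def shape_im_def\<close>)
  moreover have "angle_at Z X Y = \<theta>3"
    by (rule angle_at_eqI[where k = "d * (sin \<theta>1 * sin \<theta>2 / (sin \<theta>3)\<^sup>2)"])
       (use iZ pq cZ pos d assms in \<open>auto simp: q_def shape_im_def power2_eq_square\<close>)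
  moreover have "\<not> collinear {X, Y, Z}"
    using cX d q by (auto simp: collinear_iff_cross2)
  ultimately show ?L by blast
qed

section \<open>Triangles inscribed in the side lines\<close>

text \<open>
  The vector \<open>f\<close> for which inscribed triangles with apex \<open>apex p q X Y\<close> are characterized by the
  equation \<open>cross2 f (Y - X) = - D\<close>. It comes from adding the equations of the three side lines,
  in which \<open>X\<close> cancels because \<open>(C - B) + (A - C) + (B - A) = 0\<close>.
\<close>

definition base_normal :: "point \<Rightarrow> point \<Rightarrow> point \<Rightarrow> real \<Rightarrow> real \<Rightarrow> point" where
  "base_normal A B C p q = (A - C) + p *\<^sub>R (B - A) - q *\<^sub>R perp (B - A)"

text \<open>Twice the signed area, positive for a counterclockwise triangle.\<close>

definition signed_area2 :: "point \<Rightarrow> point \<Rightarrow> point \<Rightarrow> real" where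
  "signed_area2 A B C = cross2 (B - A) (C - A)"

lemma distinct_if_signed_area2:
  assumes "signed_area2 A B C \<noteq> 0"
  shows "A \<noteq> B" "B \<noteq> C" "A \<noteq> C"
  using assms by (auto simp: signed_area2_def cross2_def algebra_simps)

lemma inscribed_apex_unique:
  assumes D: "signed_area2 A B C \<noteq> 0"
  shows "(\<exists>X. X \<in> line B C \<and> X + s \<in> line A C \<and> apex p q X (X + s) \<in> line A B)
      \<longleftrightarrow> cross2 (base_normal A B C p q) s = - signed_area2 A B C" (is ?iff)
    and "X \<in> line B C \<Longrightarrow> X + s \<in> line A C \<Longrightarrow> X' \<in> line B C \<Longrightarrow> X' + s \<in> line A C \<Longrightarrow> X = X'"
proof -
  note ne = distinct_if_signed_area2[OF D]
  let ?a = "perp (C - B)" and ?b = "perp (C - A)"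
  let ?r = "cross2 (C - B) B" and ?t = "cross2 (C - A) (A - s)"
  have uniq: "\<exists>!X. ?a \<bullet> X = ?r \<and> ?b \<bullet> X = ?t"
    by (rule linear_system_unique_solution)
       (use D in \<open>simp add: signed_area2_def cross2_def algebra_simps\<close>)
  have lines: "X \<in> line B C \<and> X + s \<in> line A C \<longleftrightarrow> ?a \<bullet> X = ?r \<and> ?b \<bullet> X = ?t" for X
    unfolding mem_line_iff[OF ne(2)] mem_line_iff[OF ne(3)]
    by (auto simp: cross2_def inner_2 algebra_simps)
  show "X \<in> line B C \<Longrightarrow> X + s \<in> line A C \<Longrightarrow> X' \<in> line B C \<Longrightarrow> X' + s \<in> line A C \<Longrightarrow> X = X'"
    using uniq lines by blast
  have third: "apex p q X (X + s) \<in> line A B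
      \<longleftrightarrow> cross2 (base_normal A B C p q) s = - signed_area2 A B C"
    if "X \<in> line B C" "X + s \<in> line A C" for X
  proof -
    have "cross2 (C - B) (X - B) = 0" "cross2 (C - A) (X + s - A) = 0"
      using that by (simp_all only: mem_line_iff[OF ne(2)] mem_line_iff[OF ne(3)])
    moreover have "cross2 (B - A) (apex p q X (X + s) - A)
        = cross2 (base_normal A B C p q) s + signed_area2 A B C
          - cross2 (C - B) (X - B) + cross2 (C - A) (X + s - A)"
      by (simp add: cross2_def signed_area2_def base_normal_def apex_def algebra_simps)
    ultimately show ?thesis
      unfolding mem_line_iff[OF ne(1)] by auto
  qed
  show ?iff
    using uniq lines third by metis
qed

text \<open>
  Reversing the orientation of the inscribed triangle replaces \<open>q\<close> by \<open>- q\<close>. The identity shows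
  that the vector is longer for the orientation of \<open>ABC\<close>.
\<close>

lemma base_normal_norm_diff:
  "base_normal A B C p q \<bullet> base_normal A B C p q
    = base_normal A B C p (- q) \<bullet> base_normal A B C p (- q) + 4 * q * signed_area2 A B C"
  by (simp add: base_normal_def signed_area2_def cross2_def inner_2 algebra_simps)


lemma eq_if_cross2_inner_eq:
  assumes "f \<noteq> 0" "cross2 f s = cross2 f s'" "f \<bullet> s = f \<bullet> s'"
  shows "s = s'"
proof -
  have "cross2 (perp f) f \<noteq> 0"
    using assms(1) inner_gt_zero_iff[of f] by (auto simp: cross2_def inner_2)
  then have "\<exists>!P. perp f \<bullet> P = cross2 f s \<and> f \<bullet> P = f \<bullet> s"
    by (rule linear_system_unique_solution)
  moreover have "perp f \<bullet> v = cross2 f v" for v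
    by (simp add: cross2_def inner_2)
  ultimately show ?thesis using assms by metis
qed

lemma triangle_area_apex:
  assumes "\<epsilon> \<in> {1, -1}" "q > 0"
  shows "triangle_area (X, Y, apex p (\<epsilon> * q) X Y) = q * ((Y - X) \<bullet> (Y - X)) / 2"
  using assms by (auto simp: triangle_area_eq cross2_apex abs_mult simp del: triangle_area.simps)

lemma inscribed_class_iff:
  assumes "0 < \<theta>1" "0 < \<theta>2" "0 < \<theta>3" "\<theta>1 + \<theta>2 + \<theta>3 = pi"
  shows "(X, Y, Z) \<in> inscribed_class A B C \<theta>1 \<theta>2 \<theta>3 \<longleftrightarrow>
    X \<noteq> Y \<and> X \<in> line B C \<and> Y \<in> line A C \<and> Z \<in> line A B \<and>
    (\<exists>\<epsilon>\<in>{1, -1}. Z = apex (shape_re \<theta>1 \<theta>2 \<theta>3) (\<epsilon> * shape_im \<theta>1 \<theta>2 \<theta>3) X Y)"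
  using similar_iff_apex[OF assms, of X Y Z] unfolding inscribed_class_def by auto

section \<open>The minimizer and its pedal point\<close>

text \<open>
  The minimizer has the orientation of \<open>ABC\<close>, and its base \<open>Y - X\<close> is the shortest solution of
  the incidence equation.
\<close>

lemma min_triangle_eq:
  assumes D: "signed_area2 A B C \<noteq> 0"
    and \<theta>: "0 < \<theta>1" "0 < \<theta>2" "0 < \<theta>3" "\<theta>1 + \<theta>2 + \<theta>3 = pi"
  defines "p \<equiv> shape_re \<theta>1 \<theta>2 \<theta>3"
    and "q \<equiv> sgn (signed_area2 A B C) * shape_im \<theta>1 \<theta>2 \<theta>3"
  obtains X Y where "X \<noteq> Y" "X \<in> line B C" "Y \<in> line A C" "apex p q X Y \<in> line A B"
    "base_normal A B C p q \<bullet> (Y - X) = 0"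
    "min_triangle A B C \<theta>1 \<theta>2 \<theta>3 = (X, Y, apex p q X Y)"
proof -
  let ?D = "signed_area2 A B C" and ?q = "shape_im \<theta>1 \<theta>2 \<theta>3"
    and ?S = "inscribed_class A B C \<theta>1 \<theta>2 \<theta>3"
  define f where "f = base_normal A B C p q"
  define f' where "f' = base_normal A B C p (- q)"
  \<comment> \<open>the solution of the incidence equation that is orthogonal to f\<close>
  define s where "s = (- (?D / (f \<bullet> f))) *\<^sub>R perp f"
  have "sin \<theta>1 > 0" "sin \<theta>2 > 0" "sin \<theta>3 > 0"
    using \<theta> by (auto intro!: sin_gt_zero)
  then have q0: "?q > 0" by (simp add: shape_im_def)
  have sgnD: "sgn ?D \<in> {1, -1}" using D by (auto simp: sgn_if)
  have "q * ?D = ?q * \<bar>?D\<bar>"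
    by (simp add: q_def sgn_if)
  then have ff': "f' \<bullet> f' < f \<bullet> f"
    using base_normal_norm_diff[of A B C p q] q0 D by (simp add: f_def f'_def)
  then have ff: "f \<bullet> f > 0"
    by (meson inner_ge_zero le_less_trans)
  then have f0: "f \<noteq> 0" by auto
  have "cross2 f (perp f) = f \<bullet> f" "f \<bullet> perp f = 0"
    by (simp_all add: cross2_def inner_2)
  moreover have "cross2 f ((- k) *\<^sub>R v) = - (k * cross2 f v)" for k v
    by (simp add: cross2_def algebra_simps)
  ultimately have cs: "cross2 f s = - ?D" and fs: "f \<bullet> s = 0"
    using ff by (simp_all add: s_def del: scaleR_minus_left)
  have ss: "(f \<bullet> f) * (s \<bullet> s) = ?D\<^sup>2"
    using lagrange_identity[of f s] cs fs by simp
  have s0: "s \<noteq> 0" using cs D by (auto simp: cross2_def)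
  then have ss0: "s \<bullet> s > 0" by simp
  obtain X where X: "X \<in> line B C" "X + s \<in> line A C" "apex p q X (X + s) \<in> line A B"
    using inscribed_apex_unique(1)[OF D, of s p q] cs by (auto simp: f_def)
  define T where "T = (X, X + s, apex p q X (X + s))"
  have T: "T \<in> ?S"
    unfolding T_def inscribed_class_iff[OF \<theta>] using X s0 sgnD by (auto simp: p_def q_def)
  have areaT: "triangle_area T = ?q * (s \<bullet> s) / 2"
    unfolding T_def q_def triangle_area_apex[OF sgnD q0] by simp
  have larger: "triangle_area T < triangle_area T'" if "T' \<in> ?S" "T' \<noteq> T" for T'
  proof -
    obtain X' Y' Z' where T': "T' = (X', Y', Z')" by (cases T')
    define s' where "s' = Y' - X'"
    have Y': "Y' = X' + s'" by (simp add: s'_def)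
    from that(1) have on: "X' \<in> line B C" "X' + s' \<in> line A C" "Z' \<in> line A B"
      and "\<exists>\<epsilon>\<in>{1, -1}. Z' = apex p (\<epsilon> * ?q) X' Y'"
      unfolding T' inscribed_class_iff[OF \<theta>] p_def Y'[symmetric] by safe
    then obtain \<epsilon> where \<epsilon>: "\<epsilon> \<in> {1, -1}" and Z': "Z' = apex p (\<epsilon> * ?q) X' Y'"
      by (elim bexE)
    have areaT': "triangle_area T' = ?q * (s' \<bullet> s') / 2"
      unfolding T' Z' triangle_area_apex[OF \<epsilon> q0] s'_def ..
    have c: "cross2 (base_normal A B C p (\<epsilon> * ?q)) s' = - ?D"
      using inscribed_apex_unique(1)[OF D, of s' p "\<epsilon> * ?q"] on Z' Y' by auto
    have "s \<bullet> s < s' \<bullet> s'"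
    proof (cases "\<epsilon> = sgn ?D")
      case True
      then have c': "cross2 f s' = - ?D" using c by (simp add: f_def q_def)
      have "s' \<noteq> s"
        using that(2) inscribed_apex_unique(2)[OF D, of X s X'] X on True
        by (auto simp: T' T_def Y' Z' q_def)
      then have "f \<bullet> s' \<noteq> 0"
        using eq_if_cross2_inner_eq[OF f0, of s s'] cs fs c' by auto
      then have "(f \<bullet> f) * (s \<bullet> s) < (f \<bullet> f) * (s' \<bullet> s')"
        using lagrange_identity[of f s'] c' ss by simp
      then show ?thesis using ff by simp
    next
      case False
      then have "\<epsilon> * ?q = - q" using \<epsilon> sgnD by (auto simp: q_def)
      then have c': "cross2 f' s' = - ?D" using c by (simp add: f'_def)
      have "(f \<bullet> f) * (s \<bullet> s) \<le> (f' \<bullet> f') * (s' \<bullet> s')"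
        using lagrange_identity[of f' s'] c' ss by simp
      moreover have "(f' \<bullet> f') * (s \<bullet> s) < (f \<bullet> f) * (s \<bullet> s)"
        using ff' ss0 by simp
      ultimately have "(f' \<bullet> f') * (s \<bullet> s) < (f' \<bullet> f') * (s' \<bullet> s')" by linarith
      then show ?thesis
        using inner_ge_zero[of f'] by (simp add: mult_less_cancel_left)
    qed
    then have "?q * (s \<bullet> s) < ?q * (s' \<bullet> s')" using q0 by (rule mult_strict_left_mono)
    then show ?thesis unfolding areaT areaT' by simp
  qed
  have "min_triangle A B C \<theta>1 \<theta>2 \<theta>3 = T"
    unfolding min_triangle_def is_area_minimizing_def
  proof (rule the_equality)
    show "T \<in> ?S \<and> (\<forall>T' \<in> ?S. triangle_area T \<le> triangle_area T')"
      using T larger by (metis less_imp_le order_refl)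
    show "T' = T" if "T' \<in> ?S \<and> (\<forall>T'' \<in> ?S. triangle_area T' \<le> triangle_area T'')" for T'
      using that T larger[of T'] by (meson not_le)
  qed
  then show ?thesis
    using that[of X "X + s"] X s0 fs by (simp add: T_def f_def)
qed

text \<open>
  The assumption \<open>compat\<close> expresses that the perpendiculars at \<open>X\<close>, \<open>Y\<close>, \<open>Z\<close> to the side lines
  are concurrent: the side vectors add up to zero, so a point on two of the perpendiculars is on
  the third.
\<close>

lemma pedal_point_is_pedal:
  assumes D: "signed_area2 A B C \<noteq> 0"
    and "X \<in> line B C" "Y \<in> line A C" "Z \<in> line A B"
    and compat: "(A - C) \<bullet> (Y - X) + (B - A) \<bullet> (Z - X) = 0"
  shows "is_pedal_triangle A B C (pedal_point A B C (X, Y, Z)) (X, Y, Z)"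
proof -
  have "cross2 (C - B) (C - A) \<noteq> 0"
    using D by (simp add: signed_area2_def cross2_def algebra_simps)
  then have "\<exists>!P. (C - B) \<bullet> P = (C - B) \<bullet> X \<and> (C - A) \<bullet> P = (C - A) \<bullet> Y"
    by (rule linear_system_unique_solution)
  moreover have "is_pedal_triangle A B C P (X, Y, Z)
      \<longleftrightarrow> (C - B) \<bullet> P = (C - B) \<bullet> X \<and> (C - A) \<bullet> P = (C - A) \<bullet> Y" for P
    using assms(2-4) compat
    by (auto simp: is_foot_def orthogonal_def inner_2 algebra_simps)
  ultimately have "\<exists>!P. is_pedal_triangle A B C P (X, Y, Z)" by simp
  then show ?thesis unfolding pedal_point_def by (rule theI')
qed

section \<open>Sides and area of a pedal triangle\<close>

lemma is_foot_eq:
  assumes "is_foot P A B F" "A \<noteq> B"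
  shows "((B - A) \<bullet> (B - A)) *\<^sub>R (F - P) = - cross2 (B - A) (P - A) *\<^sub>R perp (B - A)"
proof -
  have "cross2 (B - A) (F - A) = 0" "(B - A) \<bullet> (F - P) = 0"
    using assms by (auto simp: is_foot_def mem_line_iff orthogonal_def inner_2 algebra_simps)
  moreover have "(s \<bullet> s) *\<^sub>R v = (s \<bullet> v) *\<^sub>R s + cross2 s v *\<^sub>R perp s" for s v
    by (simp add: coords algebra_simps)
  moreover have "cross2 (B - A) (F - P) = cross2 (B - A) (F - A) - cross2 (B - A) (P - A)"
    by (simp add: cross2_def algebra_simps)
  ultimately show ?thesis by simp
qed

lemma is_foot_commute: "is_foot P A B F \<longleftrightarrow> is_foot P B A F"
  by (auto simp: is_foot_def orthogonal_def inner_diff_right insert_commute)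

text \<open>
  Up to the common factor, \<open>ZY = AP sin A\<close>: the points \<open>A, Z, P, Y\<close> lie on the circle with
  diameter \<open>AP\<close>.
\<close>

lemma pedal_side:
  assumes "is_foot P A B Z" "is_foot P A C Y" "A \<noteq> B" "A \<noteq> C"
  shows "((B - A) \<bullet> (B - A)) * ((C - A) \<bullet> (C - A)) * ((Z - Y) \<bullet> (Z - Y))
    = (cross2 (B - A) (C - A))\<^sup>2 * ((P - A) \<bullet> (P - A))"
proof -
  define u v w where "u = B - A" and "v = C - A" and "w = P - A"
  have "(u \<bullet> u) *\<^sub>R (Z - P) = - cross2 u w *\<^sub>R perp u"
    "(v \<bullet> v) *\<^sub>R (Y - P) = - cross2 v w *\<^sub>R perp v"
    unfolding u_def v_def w_def using is_foot_eq[OF assms(1,3)] is_foot_eq[OF assms(2,4)] .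
  moreover have "((u \<bullet> u) * (v \<bullet> v)) *\<^sub>R (Z - Y)
      = (v \<bullet> v) *\<^sub>R ((u \<bullet> u) *\<^sub>R (Z - P)) - (u \<bullet> u) *\<^sub>R ((v \<bullet> v) *\<^sub>R (Y - P))"
    by (simp add: algebra_simps)
  ultimately have diff: "((u \<bullet> u) * (v \<bullet> v)) *\<^sub>R (Z - Y)
      = ((u \<bullet> u) * cross2 v w) *\<^sub>R perp v - ((v \<bullet> v) * cross2 u w) *\<^sub>R perp u"
    by simp
  let ?k = "(u \<bullet> u) * (v \<bullet> v)"
  have k: "?k \<noteq> 0" using assms by (simp add: u_def v_def)
  have "?k * (?k * ((Z - Y) \<bullet> (Z - Y))) = (?k *\<^sub>R (Z - Y)) \<bullet> (?k *\<^sub>R (Z - Y))"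
    by simp
  also have "\<dots> = ?k * ((cross2 u v)\<^sup>2 * (w \<bullet> w))"
    unfolding diff by (simp add: inner_2 cross2_def algebra_simps power2_eq_square)
  finally show ?thesis using k by (simp add: u_def v_def w_def)
qed

text \<open>The two equations say that \<open>O'\<close> is equidistant from \<open>A\<close>, \<open>B\<close> and from \<open>A\<close>, \<open>C\<close>.\<close>

lemma circumcenter_exists:
  assumes "signed_area2 A B C \<noteq> 0"
  obtains O' where "(O' - A) \<bullet> (B - A) = ((B - A) \<bullet> (B - A)) / 2"
    "(O' - A) \<bullet> (C - A) = ((C - A) \<bullet> (C - A)) / 2"
proof -
  obtain h where "(B - A) \<bullet> h = ((B - A) \<bullet> (B - A)) / 2" "(C - A) \<bullet> h = ((C - A) \<bullet> (C - A)) / 2"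
    using linear_system_unique_solution[of "B - A" "C - A"] assms unfolding signed_area2_def by metis
  then show ?thesis using that[of "A + h"] by (simp add: inner_commute)
qed

text \<open>
  Euler's formula: the signed area of the pedal triangle is proportional to the power of \<open>P\<close> with
  respect to the circumcircle of \<open>ABC\<close>, whose center is \<open>O'\<close>.
\<close>

lemma pedal_area:
  assumes "is_foot P B C X" "is_foot P A C Y" "is_foot P A B Z" "signed_area2 A B C \<noteq> 0"
    and O': "(O' - A) \<bullet> (B - A) = ((B - A) \<bullet> (B - A)) / 2"
    "(O' - A) \<bullet> (C - A) = ((C - A) \<bullet> (C - A)) / 2"
  shows "((C - B) \<bullet> (C - B)) * ((C - A) \<bullet> (C - A)) * ((B - A) \<bullet> (B - A)) * cross2 (Y - X) (Z - X)
    = (signed_area2 A B C)^3 * ((A - O') \<bullet> (A - O') - (P - O') \<bullet> (P - O'))"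
proof -
  define u v w h where "u = B - A" and "v = C - A" and "w = P - A" and "h = O' - A"
  define x y z where "x = X - P" and "y = Y - P" and "z = Z - P"
  define a where "a = (v - u) \<bullet> (v - u)"
  let ?b = "v \<bullet> v" and ?c = "u \<bullet> u" and ?D = "cross2 u v"
  define d1 d2 d3 where "d1 = cross2 (v - u) (w - u)" and "d2 = cross2 v w" and "d3 = cross2 u w"
  note ne = distinct_if_signed_area2[OF assms(4)]
  have vu: "C - B = v - u" "P - B = w - u" by (simp_all add: u_def v_def w_def)
  have x: "a *\<^sub>R x = - d1 *\<^sub>R perp (v - u)"
    using is_foot_eq[OF assms(1) ne(2)] by (simp add: vu a_def x_def d1_def)
  have y: "?b *\<^sub>R y = - d2 *\<^sub>R perp v"
    using is_foot_eq[OF assms(2) ne(3)] by (simp add: v_def y_def d2_def w_def)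
  have z: "?c *\<^sub>R z = - d3 *\<^sub>R perp u"
    using is_foot_eq[OF assms(3) ne(1)] by (simp add: u_def z_def d3_def w_def)
  have scale: "cross2 (k *\<^sub>R s) (l *\<^sub>R t) = k * l * cross2 s t" for k l s t
    by (simp add: cross2_def algebra_simps)
  have "cross2 (Y - X) (Z - X) = cross2 x y + cross2 y z + cross2 z x"
    by (simp add: x_def y_def z_def cross2_def algebra_simps)
  then have "a * ?b * ?c * cross2 (Y - X) (Z - X)
      = ?c * (a * ?b * cross2 x y) + a * (?b * ?c * cross2 y z) + ?b * (?c * a * cross2 z x)"
    by (simp add: algebra_simps)
  also have "\<dots> = ?D * (?b * d1 * d3 - ?c * d1 * d2 - a * d2 * d3)"
    unfolding scale[symmetric] x y z unfolding scale
    by (simp add: cross2_def algebra_simps)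
  also have "?b * d1 * d3 - ?c * d1 * d2 - a * d2 * d3 = ?D * (d3 * ?b - d2 * ?c - ?D * (w \<bullet> w))"
    by (simp add: a_def d1_def d2_def d3_def cross2_def inner_2 algebra_simps)
  also have "d3 * ?b - d2 * ?c = 2 * ?D * (w \<bullet> h)"
  proof -
    have "?D * (w \<bullet> h) = d3 * (h \<bullet> v) - d2 * (h \<bullet> u)"
      by (simp add: d3_def d2_def cross2_def inner_2 algebra_simps)
    then show ?thesis using O' by (simp add: u_def v_def h_def)
  qed
  also have "?D * (?D * (2 * ?D * (w \<bullet> h) - ?D * (w \<bullet> w))) = ?D^3 * (h \<bullet> h - (w - h) \<bullet> (w - h))"
    by (simp add: inner_diff_left inner_diff_right inner_commute algebra_simps power3_eq_cube)
  finally show ?thesis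
    by (simp add: u_def v_def w_def h_def a_def signed_area2_def norm_minus_commute dot_square_norm
        inner_commute)
qed

section \<open>The common circle\<close>

text \<open>
  The ratio of the sum of the squared sides to twice the area is
  \<open>(sin\<^sup>2 \<theta>1 + sin\<^sup>2 \<theta>2 + sin\<^sup>2 \<theta>3) / (sin \<theta>1 sin \<theta>2 sin \<theta>3)\<close>, by the law of sines. It is symmetric in
  the angles, which is what puts the six pedal points on one circle.
\<close>

lemma apex_sides:
  fixes X Y :: point
  assumes "0 < \<theta>1" "0 < \<theta>2" "0 < \<theta>3" "\<theta>1 + \<theta>2 + \<theta>3 = pi" "\<epsilon> \<in> {1, -1}"
  defines "Z \<equiv> apex (shape_re \<theta>1 \<theta>2 \<theta>3) (\<epsilon> * shape_im \<theta>1 \<theta>2 \<theta>3) X Y"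
  shows "(sin \<theta>1 * sin \<theta>2 * sin \<theta>3) * ((Z - Y) \<bullet> (Z - Y) + (Z - X) \<bullet> (Z - X) + (Y - X) \<bullet> (Y - X))
    = ((sin \<theta>1)\<^sup>2 + (sin \<theta>2)\<^sup>2 + (sin \<theta>3)\<^sup>2) * (\<epsilon> * cross2 (Y - X) (Z - X))"
proof -
  define p q d where "p = shape_re \<theta>1 \<theta>2 \<theta>3" and "q = shape_im \<theta>1 \<theta>2 \<theta>3"
    and "d = (Y - X) \<bullet> (Y - X)"
  have s: "sin \<theta>3 > 0" using assms by (auto intro!: sin_gt_zero)
  have eps: "\<epsilon> * \<epsilon> = 1" using assms(5) by auto
  have "\<theta>3 = pi - (\<theta>1 + \<theta>2)" using assms(4) by simp
  then have s3: "sin \<theta>3 = sin \<theta>1 * cos \<theta>2 + cos \<theta>1 * sin \<theta>2"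
    by (simp only: sin_pi_minus sin_add)
  have cross: "\<epsilon> * cross2 (Y - X) (Z - X) = q * d"
    using eps by (simp add: Z_def cross2_apex q_def d_def mult.assoc[symmetric])
  have ZX: "(Z - X) \<bullet> (Z - X) = d * (p\<^sup>2 + (\<epsilon> * \<epsilon>) * q\<^sup>2)"
    by (simp add: Z_def p_def q_def apex_def d_def inner_2 algebra_simps power2_eq_square)
  have ZY: "(Z - Y) \<bullet> (Z - Y) = d * ((1 - p)\<^sup>2 + (\<epsilon> * \<epsilon>) * q\<^sup>2)"
    by (simp add: Z_def p_def q_def apex_def d_def inner_2 algebra_simps power2_eq_square)
  have p3: "sin \<theta>3 * p = sin \<theta>2 * cos \<theta>1" "sin \<theta>3 * q = sin \<theta>2 * sin \<theta>1"
    "sin \<theta>3 * (1 - p) = sin \<theta>1 * cos \<theta>2"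
    using s s3 by (simp_all add: p_def q_def shape_re_def shape_im_def field_simps)
  have "(sin \<theta>3)\<^sup>2 * (p\<^sup>2 + q\<^sup>2) = (sin \<theta>3 * p)\<^sup>2 + (sin \<theta>3 * q)\<^sup>2"
    by (simp add: power_mult_distrib algebra_simps)
  also have "\<dots> = (sin \<theta>2)\<^sup>2 * ((cos \<theta>1)\<^sup>2 + (sin \<theta>1)\<^sup>2)"
    unfolding p3 power_mult_distrib distrib_left ..
  finally have m: "(sin \<theta>3)\<^sup>2 * (p\<^sup>2 + q\<^sup>2) = (sin \<theta>2)\<^sup>2" by simp
  have "(sin \<theta>3)\<^sup>2 * ((1 - p)\<^sup>2 + q\<^sup>2) = (sin \<theta>3 * (1 - p))\<^sup>2 + (sin \<theta>3 * q)\<^sup>2"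
    by (simp only: power_mult_distrib distrib_left)
  also have "\<dots> = (sin \<theta>1)\<^sup>2 * ((cos \<theta>2)\<^sup>2 + (sin \<theta>2)\<^sup>2)"
    unfolding p3 power_mult_distrib distrib_left by (simp add: mult_ac)
  finally have n: "(sin \<theta>3)\<^sup>2 * ((1 - p)\<^sup>2 + q\<^sup>2) = (sin \<theta>1)\<^sup>2" by simp
  have "(sin \<theta>1 * sin \<theta>2 * sin \<theta>3) * ((Z - Y) \<bullet> (Z - Y) + (Z - X) \<bullet> (Z - X) + (Y - X) \<bullet> (Y - X))
      = (sin \<theta>3 * q) * sin \<theta>3 * d * (((1 - p)\<^sup>2 + q\<^sup>2) + (p\<^sup>2 + q\<^sup>2) + 1)"
    unfolding ZX ZY eps p3(2) by (simp add: d_def algebra_simps)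
  also have "\<dots> = q * d * ((sin \<theta>3)\<^sup>2 * ((1 - p)\<^sup>2 + q\<^sup>2) + (sin \<theta>3)\<^sup>2 * (p\<^sup>2 + q\<^sup>2) + (sin \<theta>3)\<^sup>2)"
    by (simp add: power2_eq_square algebra_simps)
  finally show ?thesis unfolding m n cross by (simp add: mult_ac)
qed

lemma min_pedal_point_eqn:
  assumes D: "signed_area2 A B C \<noteq> 0"
    and \<theta>: "0 < \<theta>1" "0 < \<theta>2" "0 < \<theta>3" "\<theta>1 + \<theta>2 + \<theta>3 = pi"
    and O': "(O' - A) \<bullet> (B - A) = ((B - A) \<bullet> (B - A)) / 2"
    "(O' - A) \<bullet> (C - A) = ((C - A) \<bullet> (C - A)) / 2"
  defines "P \<equiv> min_pedal_point A B C \<theta>1 \<theta>2 \<theta>3"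
  shows "(sin \<theta>1 * sin \<theta>2 * sin \<theta>3) * (((C - B) \<bullet> (C - B)) * ((P - A) \<bullet> (P - A))
      + ((C - A) \<bullet> (C - A)) * ((P - B) \<bullet> (P - B)) + ((B - A) \<bullet> (B - A)) * ((P - C) \<bullet> (P - C)))
    = ((sin \<theta>1)\<^sup>2 + (sin \<theta>2)\<^sup>2 + (sin \<theta>3)\<^sup>2) * \<bar>signed_area2 A B C\<bar>
      * ((A - O') \<bullet> (A - O') - (P - O') \<bullet> (P - O'))"
proof -
  define p q where "p = shape_re \<theta>1 \<theta>2 \<theta>3"
    and "q = sgn (signed_area2 A B C) * shape_im \<theta>1 \<theta>2 \<theta>3"
  let ?D = "signed_area2 A B C"
  obtain X Y where on: "X \<in> line B C" "Y \<in> line A C" "apex p q X Y \<in> line A B"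
    and normal: "base_normal A B C p q \<bullet> (Y - X) = 0"
    and min: "min_triangle A B C \<theta>1 \<theta>2 \<theta>3 = (X, Y, apex p q X Y)"
    by (rule min_triangle_eq[OF D \<theta>, folded p_def q_def])
  define Z where "Z = apex p q X Y"
  \<comment> \<open>minimality of the base is exactly concurrency of the perpendiculars\<close>
  have "(A - C) \<bullet> (Y - X) + (B - A) \<bullet> (Z - X) = base_normal A B C p q \<bullet> (Y - X)"
    by (simp add: Z_def apex_def base_normal_def inner_2 algebra_simps)
  then have "is_pedal_triangle A B C P (X, Y, Z)"
    unfolding P_def min_pedal_point_def min Z_def[symmetric]
    using on normal by (intro pedal_point_is_pedal[OF D]) (auto simp: Z_def)
  then have feet: "is_foot P B C X" "is_foot P A C Y" "is_foot P A B Z" by auto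
  have feet': "is_foot P B A Z" "is_foot P C B X" "is_foot P C A Y"
    using feet is_foot_commute[of P B A] is_foot_commute[of P C B] is_foot_commute[of P C A]
    by simp_all
  note ne = distinct_if_signed_area2[OF D]
  let ?a = "(C - B) \<bullet> (C - B)" and ?b = "(C - A) \<bullet> (C - A)" and ?c = "(B - A) \<bullet> (B - A)"
  let ?S = "sin \<theta>1 * sin \<theta>2 * sin \<theta>3" and ?Q = "(sin \<theta>1)\<^sup>2 + (sin \<theta>2)\<^sup>2 + (sin \<theta>3)\<^sup>2"
  have sq: "(A - B) \<bullet> (A - B) = ?c" "(A - C) \<bullet> (A - C) = ?b" "(B - C) \<bullet> (B - C) = ?a"
    "(X - Y) \<bullet> (X - Y) = (Y - X) \<bullet> (Y - X)"
    by (simp_all add: inner_2 algebra_simps)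
  have cr: "(cross2 (B - A) (C - A))\<^sup>2 = ?D\<^sup>2" "(cross2 (A - B) (C - B))\<^sup>2 = ?D\<^sup>2"
    "(cross2 (B - C) (A - C))\<^sup>2 = ?D\<^sup>2"
    by (simp_all add: signed_area2_def cross2_def power2_eq_square algebra_simps)
  have 1: "?c * ?b * ((Z - Y) \<bullet> (Z - Y)) = ?D\<^sup>2 * ((P - A) \<bullet> (P - A))"
    using pedal_side[OF feet(3,2)] ne cr by simp
  have 2: "?c * ?a * ((Z - X) \<bullet> (Z - X)) = ?D\<^sup>2 * ((P - B) \<bullet> (P - B))"
    using pedal_side[OF feet'(1) feet(1) ne(1)[symmetric] ne(2)] by (simp only: cr sq)
  have 3: "?a * ?b * ((Y - X) \<bullet> (Y - X)) = ?D\<^sup>2 * ((P - C) \<bullet> (P - C))"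
    using pedal_side[OF feet'(2,3) ne(2,3)[symmetric]] by (simp only: cr sq)
  have "sgn ?D \<in> {1, -1}" using D by (auto simp: sgn_if)
  from apex_sides[OF \<theta> this, of X Y]
  have sides: "?S * ((Z - Y) \<bullet> (Z - Y) + (Z - X) \<bullet> (Z - X) + (Y - X) \<bullet> (Y - X))
      = ?Q * (sgn ?D * cross2 (Y - X) (Z - X))"
    by (simp add: Z_def p_def q_def)
  have "?D\<^sup>2 * (?S * (?a * ((P - A) \<bullet> (P - A)) + ?b * ((P - B) \<bullet> (P - B)) + ?c * ((P - C) \<bullet> (P - C))))
      = ?S * (?a * (?c * ?b * ((Z - Y) \<bullet> (Z - Y))) + ?b * (?c * ?a * ((Z - X) \<bullet> (Z - X)))
          + ?c * (?a * ?b * ((Y - X) \<bullet> (Y - X))))"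
    unfolding 1 2 3 by (simp only: distrib_left mult_ac)
  also have "\<dots> = ?a * ?b * ?c * (?S * ((Z - Y) \<bullet> (Z - Y) + (Z - X) \<bullet> (Z - X) + (Y - X) \<bullet> (Y - X)))"
    by (simp only: distrib_left mult_ac)
  also have "\<dots> = ?Q * sgn ?D * (?a * ?b * ?c * cross2 (Y - X) (Z - X))"
    unfolding sides by (simp only: distrib_left mult_ac)
  also have "\<dots> = ?Q * sgn ?D * (?D ^ 3 * ((A - O') \<bullet> (A - O') - (P - O') \<bullet> (P - O')))"
    unfolding pedal_area[OF feet D O'] ..
  also have "\<dots> = ?Q * (sgn ?D * ?D ^ 3) * ((A - O') \<bullet> (A - O') - (P - O') \<bullet> (P - O'))"
    by (simp only: mult_ac)
  also have "sgn ?D * ?D ^ 3 = ?D\<^sup>2 * \<bar>?D\<bar>"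
    by (simp add: sgn_if abs_if power2_eq_square power3_eq_cube)
  finally have "?D\<^sup>2 * (?S * (?a * ((P - A) \<bullet> (P - A)) + ?b * ((P - B) \<bullet> (P - B)) + ?c * ((P - C) \<bullet> (P - C))))
      = ?D\<^sup>2 * (?Q * \<bar>?D\<bar> * ((A - O') \<bullet> (A - O') - (P - O') \<bullet> (P - O')))"
    by (simp only: mult_ac)
  then show ?thesis
    by (rule mult_left_cancel[THEN iffD1, rotated]) (simp add: D)
qed

text \<open>
  If the equation has a single solution, then any circle through that point serves; this occurs
  for an equilateral shape, where the six pedal points coincide.
\<close>

lemma quadratic_locus_subset_sphere:
  fixes v :: point
  assumes "k > 0"
  obtains c r where "r > 0" "{P. k * (P \<bullet> P) + v \<bullet> P = t} \<subseteq> sphere c r"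
proof -
  define c where "c = - (1 / (2 * k)) *\<^sub>R v"
  define \<rho> where "\<rho> = t / k + c \<bullet> c"
  have dist: "(dist c P)\<^sup>2 = \<rho>" if "k * (P \<bullet> P) + v \<bullet> P = t" for P
  proof -
    have "(dist c P)\<^sup>2 = P \<bullet> P - 2 * (c \<bullet> P) + c \<bullet> c"
      by (simp add: dist_norm power2_norm_eq_inner inner_diff_left inner_diff_right inner_commute)
    also have "P \<bullet> P - 2 * (c \<bullet> P) = t / k"
      using assms by (simp add: c_def field_simps flip: that)
    finally show ?thesis by (simp add: \<rho>_def)
  qed
  show ?thesis
  proof (cases "\<rho> > 0")
    case True
    have "dist c P = sqrt \<rho>" if "k * (P \<bullet> P) + v \<bullet> P = t" for P
      using dist[OF that] by (metis real_sqrt_unique zero_le_dist)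
    then have "{P. k * (P \<bullet> P) + v \<bullet> P = t} \<subseteq> sphere c (sqrt \<rho>)"
      by (simp add: subset_iff)
    then show ?thesis by (rule that[rotated]) (simp add: True)
  next
    case False
    have "P = c" if "k * (P \<bullet> P) + v \<bullet> P = t" for P
      using dist[OF that] False by (metis dist_eq_0_iff zero_less_power2)
    then have "{P. k * (P \<bullet> P) + v \<bullet> P = t} \<subseteq> sphere (c + axis 1 1) 1"
      by (auto simp: dist_norm)
    then show ?thesis by (rule that[rotated]) simp
  qed
qed

theorem theorem1p1:
  fixes A B C :: point and \<alpha> \<beta> \<gamma> :: real
  assumes "\<not> collinear {A, B, C}"
    and "0 < \<alpha>" "\<alpha> < pi" and "0 < \<beta>" "\<beta> < pi" and "0 < \<gamma>" "\<gamma> < pi"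
    and "\<alpha> + \<beta> + \<gamma> = pi"
  shows "\<exists>c r. r > 0 \<and>
    {min_pedal_point A B C \<alpha> \<beta> \<gamma>, min_pedal_point A B C \<alpha> \<gamma> \<beta>,
     min_pedal_point A B C \<beta> \<alpha> \<gamma>, min_pedal_point A B C \<beta> \<gamma> \<alpha>,
     min_pedal_point A B C \<gamma> \<alpha> \<beta>, min_pedal_point A B C \<gamma> \<beta> \<alpha>} \<subseteq> sphere c r"
proof -
  have D: "signed_area2 A B C \<noteq> 0"
    using assms(1) by (simp add: collinear_iff_cross2 signed_area2_def)
  obtain O' where O': "(O' - A) \<bullet> (B - A) = ((B - A) \<bullet> (B - A)) / 2"
    "(O' - A) \<bullet> (C - A) = ((C - A) \<bullet> (C - A)) / 2"
    using circumcenter_exists[OF D] .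
  define S where "S = sin \<alpha> * sin \<beta> * sin \<gamma>"
  define K where "K = ((sin \<alpha>)\<^sup>2 + (sin \<beta>)\<^sup>2 + (sin \<gamma>)\<^sup>2) * \<bar>signed_area2 A B C\<bar>"
  define a b c where "a = S * ((C - B) \<bullet> (C - B))" and "b = S * ((C - A) \<bullet> (C - A))"
    and "c = S * ((B - A) \<bullet> (B - A))"
  define L where "L = {P. a * ((P - A) \<bullet> (P - A)) + b * ((P - B) \<bullet> (P - B)) + c * ((P - C) \<bullet> (P - C))
      = K * ((A - O') \<bullet> (A - O') - (P - O') \<bullet> (P - O'))}"
  have mem: "min_pedal_point A B C \<theta>1 \<theta>2 \<theta>3 \<in> L"
    if "0 < \<theta>1" "0 < \<theta>2" "0 < \<theta>3" "\<theta>1 + \<theta>2 + \<theta>3 = pi" "sin \<theta>1 * sin \<theta>2 * sin \<theta>3 = S"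
      "(sin \<theta>1)\<^sup>2 + (sin \<theta>2)\<^sup>2 + (sin \<theta>3)\<^sup>2 = (sin \<alpha>)\<^sup>2 + (sin \<beta>)\<^sup>2 + (sin \<gamma>)\<^sup>2" for \<theta>1 \<theta>2 \<theta>3
    using min_pedal_point_eqn[OF D that(1-4) O'] unfolding that(5,6)
    by (simp add: L_def K_def a_def b_def c_def distrib_left mult.assoc)
  have "sin \<alpha> > 0" "sin \<beta> > 0" "sin \<gamma> > 0"
    using assms by (auto intro!: sin_gt_zero)
  then have "S > 0" "K > 0"
    using D by (auto simp: S_def K_def intro!: add_pos_pos mult_pos_pos)
  then have "a + b + c + K > 0"
    by (auto simp: a_def b_def c_def intro!: add_nonneg_pos add_nonneg_nonneg)
  then obtain m r where "r > 0" and sphere: "{P. (a + b + c + K) * (P \<bullet> P)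
      + (- 2 *\<^sub>R (a *\<^sub>R A + b *\<^sub>R B + c *\<^sub>R C + K *\<^sub>R O')) \<bullet> P
      = K * ((A - O') \<bullet> (A - O')) - a * (A \<bullet> A) - b * (B \<bullet> B) - c * (C \<bullet> C) - K * (O' \<bullet> O')}
      \<subseteq> sphere m r"
    by (rule quadratic_locus_subset_sphere)
  have "L \<subseteq> sphere m r"
    by (rule subset_trans[OF _ sphere])
       (auto simp: L_def inner_add_left inner_diff_left inner_diff_right inner_commute algebra_simps)
  moreover have "{min_pedal_point A B C \<alpha> \<beta> \<gamma>, min_pedal_point A B C \<alpha> \<gamma> \<beta>,
     min_pedal_point A B C \<beta> \<alpha> \<gamma>, min_pedal_point A B C \<beta> \<gamma> \<alpha>,
     min_pedal_point A B C \<gamma> \<alpha> \<beta>, min_pedal_point A B C \<gamma> \<beta> \<alpha>} \<subseteq> L"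
    using assms by (auto intro!: mem simp: S_def mult_ac)
  ultimately show ?thesis using \<open>r > 0\<close> by blast
qed

end
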